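(* Consider the Boolean state control problem with affine dynamics: for each $v\in V$, $C_v=\{c_0,c_1\}\subset\mathbb R$ with $c_0\ne c_1$, $S_v=\mathbb R$, $\Omega_v=[\eta_v,\infty)$, $\Phi_v=(-\infty,\eta_v)$, nominal states $(s_\Phi)_v\in\Phi_v$, $(s_\Omega)_v\in\Omega_v$, and $$f_v(c_v,(s_w)_{w\in U_v})=\sum_{w\in U_v}A_{wv}s_w+B_{vv}c_v+h_v,$$ where $A$ is a real matrix with $A_{wv}=0$ if $(w,v)\notin E$, $B$ is a real diagonal matrix and $h$ is a real vector. Choose the Boolean dynamics functions $$\widetilde{f_v}(\widetilde{c_v},(\widetilde{s_w})_{w\in U_v})=H\Big(\sum_{w\in U_v}A_{wv}\big[((s_\Omega)_w-(s_\Phi)_w)\widetilde{s_w}+(s_\Phi)_w\big]+B_{vv}\big[(c_1-c_0)\widetilde{c_v}+c_0\big]+h_v-\eta_v\Big).$$ Then, for every $v\in V$, $\widetilde{f_v}=\tau_v\circ f_v\circ\gamma_v$, and no error is incurred by the thresholding process: $\widetilde{f_v}\circ\sigma_v|_{F_v}=\tau_v\circ f_v|_{F_v}$. Moreover both error terms vanish, i.e. $\widetilde{f_v}-\tau_v\circ f_v\circ\gamma_v|_{\widetilde{F_v}}=0$ and $\gamma_v\circ\sigma_v|_{F_v}-\mathrm{id}_{F_v}=0$ for every $v$.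
   Context: $G=(V,E)$ is a finite directed graph with $(v,v)\in E$ for all $v\in V$, and $U_v=\{w\in V:(w,v)\in E\}$. $R_v=C_v\times\prod_{w\in U_v}S_w$. A nominal configuration is an $s\in\prod_{v\in V}S_v$ with $s_v\in\{(s_\Phi)_v,(s_\Omega)_v\}$ for all $v$; $\mathbb S$ is the set of nominal configurations, and the feasible set is $F_v=C_v\times\mathrm{pr}_{U_v}\mathbb S$, where $\mathrm{pr}_{U_v}$ is the projection onto $\prod_{w\in U_v}S_w$. The Boolean spaces are $\widetilde{C_v}=\widetilde{S_v}=\{0,1\}$, $\widetilde{R_v}=\widetilde{C_v}\times\prod_{w\in U_v}\widetilde{S_w}$. $H$ is the Heaviside function, $H(t)=1$ for $t\ge 0$ and $H(t)=0$ for $t<0$. The thresholding functions are $\chi_v(c)=(c-c_0)/(c_1-c_0)$ on $C_v$, $\tau_v(s)=H(s-\eta_v)$ on $S_v$, and $\sigma_v(c_v,(s_w)_{w\in U_v})=(\chi_v(c_v),(\tau_w(s_w))_{w\in U_v})$. $\widetilde{F_v}=\sigma_v(F_v)$. The lifting function $\gamma_v:\widetilde{R_v}\to R_v$ is $\gamma_v(\widetilde c,(\widetilde{s_w})_{w\in U_v})=(\chi_v^{-1}(\widetilde c),(\rho_w(\widetilde{s_w}))_{w\in U_v})$ with $\chi_v^{-1}(\widetilde c)=(c_1-c_0)\widetilde c+c_0$ and $\rho_w(\widetilde s)=((s_\Omega)_w-(s_\Phi)_w)\widetilde s+(s_\Phi)_w$. *)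

theory Defs
  imports Complex_Main "HOL-Library.FuncSet"
begin

text \<open>
  A point of a product of spaces over an index set \<open>W\<close> is an extensional function on \<open>W\<close>
  (an element of \<open>Pi\<^sub>E W S\<close>), and a point of a local space is a pair of a control and such a
  function.  The Boolean values 0 and 1 are taken to be the real numbers 0 and 1, because they
  enter real affine expressions.
\<close>

definition in_nbrs :: "'v set \<Rightarrow> ('v \<times> 'v) set \<Rightarrow> 'v \<Rightarrow> 'v set" where
  "in_nbrs V E v = {w \<in> V. (w, v) \<in> E}"

definition local_space ::
  "'v set \<Rightarrow> ('v \<times> 'v) set \<Rightarrow> ('v \<Rightarrow> real set) \<Rightarrow> ('v \<Rightarrow> real set) \<Rightarrow> 'v \<Rightarrow> (real \<times> ('v \<Rightarrow> real)) set"
where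
  "local_space V E C S v = C v \<times> Pi\<^sub>E (in_nbrs V E v) S"

definition nominal_configs ::
  "'v set \<Rightarrow> ('v \<Rightarrow> real set) \<Rightarrow> ('v \<Rightarrow> real) \<Rightarrow> ('v \<Rightarrow> real) \<Rightarrow> ('v \<Rightarrow> real) set"
where
  "nominal_configs V S sPhi sOmega = {s \<in> Pi\<^sub>E V S. \<forall>v\<in>V. s v \<in> {sPhi v, sOmega v}}"

definition feasible ::
  "'v set \<Rightarrow> ('v \<times> 'v) set \<Rightarrow> ('v \<Rightarrow> real set) \<Rightarrow> ('v \<Rightarrow> real set) \<Rightarrow> ('v \<Rightarrow> real) \<Rightarrow> ('v \<Rightarrow> real)
    \<Rightarrow> 'v \<Rightarrow> (real \<times> ('v \<Rightarrow> real)) set"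
where
  "feasible V E C S sPhi sOmega v =
     C v \<times> (\<lambda>s. restrict s (in_nbrs V E v)) ` nominal_configs V S sPhi sOmega"

definition bool_space :: "'v \<Rightarrow> real set" where
  "bool_space v = {0, 1}"

definition bool_local_space ::
  "'v set \<Rightarrow> ('v \<times> 'v) set \<Rightarrow> 'v \<Rightarrow> (real \<times> ('v \<Rightarrow> real)) set"
where
  "bool_local_space V E v = local_space V E bool_space bool_space v"

definition heaviside :: "real \<Rightarrow> real" where
  "heaviside t = (if t \<ge> 0 then 1 else 0)"

definition chi :: "real \<Rightarrow> real \<Rightarrow> real \<Rightarrow> real" where
  "chi c0 c1 c = (c - c0) / (c1 - c0)"

definition chi_inv :: "real \<Rightarrow> real \<Rightarrow> real \<Rightarrow> real" where
  "chi_inv c0 c1 c = (c1 - c0) * c + c0"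

definition tau :: "('v \<Rightarrow> real) \<Rightarrow> 'v \<Rightarrow> real \<Rightarrow> real" where
  "tau eta v s = heaviside (s - eta v)"

definition rho :: "('v \<Rightarrow> real) \<Rightarrow> ('v \<Rightarrow> real) \<Rightarrow> 'v \<Rightarrow> real \<Rightarrow> real" where
  "rho sPhi sOmega w s = (sOmega w - sPhi w) * s + sPhi w"

definition sigma ::
  "'v set \<Rightarrow> ('v \<times> 'v) set \<Rightarrow> real \<Rightarrow> real \<Rightarrow> ('v \<Rightarrow> real) \<Rightarrow> 'v
    \<Rightarrow> real \<times> ('v \<Rightarrow> real) \<Rightarrow> real \<times> ('v \<Rightarrow> real)"
where
  "sigma V E c0 c1 eta v = (\<lambda>(c, s). (chi c0 c1 c, \<lambda>w\<in>in_nbrs V E v. tau eta w (s w)))"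

definition gamma ::
  "'v set \<Rightarrow> ('v \<times> 'v) set \<Rightarrow> real \<Rightarrow> real \<Rightarrow> ('v \<Rightarrow> real) \<Rightarrow> ('v \<Rightarrow> real) \<Rightarrow> 'v
    \<Rightarrow> real \<times> ('v \<Rightarrow> real) \<Rightarrow> real \<times> ('v \<Rightarrow> real)"
where
  "gamma V E c0 c1 sPhi sOmega v =
     (\<lambda>(c, s). (chi_inv c0 c1 c, \<lambda>w\<in>in_nbrs V E v. rho sPhi sOmega w (s w)))"

definition bool_feasible ::
  "'v set \<Rightarrow> ('v \<times> 'v) set \<Rightarrow> ('v \<Rightarrow> real set) \<Rightarrow> ('v \<Rightarrow> real set) \<Rightarrow> ('v \<Rightarrow> real) \<Rightarrow> ('v \<Rightarrow> real)
    \<Rightarrow> real \<Rightarrow> real \<Rightarrow> ('v \<Rightarrow> real) \<Rightarrow> 'v \<Rightarrow> (real \<times> ('v \<Rightarrow> real)) set"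
where
  "bool_feasible V E C S sPhi sOmega c0 c1 eta v =
     sigma V E c0 c1 eta v ` feasible V E C S sPhi sOmega v"

definition affine_dyn ::
  "'v set \<Rightarrow> ('v \<times> 'v) set \<Rightarrow> ('v \<Rightarrow> 'v \<Rightarrow> real) \<Rightarrow> ('v \<Rightarrow> 'v \<Rightarrow> real) \<Rightarrow> ('v \<Rightarrow> real) \<Rightarrow> 'v
    \<Rightarrow> real \<times> ('v \<Rightarrow> real) \<Rightarrow> real"
where
  "affine_dyn V E A B h v =
     (\<lambda>(c, s). (\<Sum>w\<in>in_nbrs V E v. A w v * s w) + B v v * c + h v)"

definition bool_dyn ::
  "'v set \<Rightarrow> ('v \<times> 'v) set \<Rightarrow> real \<Rightarrow> real \<Rightarrow> ('v \<Rightarrow> real) \<Rightarrow> ('v \<Rightarrow> real) \<Rightarrow> ('v \<Rightarrow> real)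
    \<Rightarrow> ('v \<Rightarrow> 'v \<Rightarrow> real) \<Rightarrow> ('v \<Rightarrow> 'v \<Rightarrow> real) \<Rightarrow> ('v \<Rightarrow> real) \<Rightarrow> 'v
    \<Rightarrow> real \<times> ('v \<Rightarrow> real) \<Rightarrow> real"
where
  "bool_dyn V E c0 c1 eta sPhi sOmega A B h v =
     (\<lambda>(c, s). heaviside
        ((\<Sum>w\<in>in_nbrs V E v. A w v * ((sOmega w - sPhi w) * s w + sPhi w))
         + B v v * ((c1 - c0) * c + c0) + h v - eta v))"

text \<open>Componentwise difference and zero in \<open>\<real> \<times> \<real>\<^sup>W\<close>, kept extensional on \<open>W\<close>.\<close>

definition local_diff ::
  "'v set \<Rightarrow> real \<times> ('v \<Rightarrow> real) \<Rightarrow> real \<times> ('v \<Rightarrow> real) \<Rightarrow> real \<times> ('v \<Rightarrow> real)"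
where
  "local_diff W r r' = (fst r - fst r', \<lambda>w\<in>W. snd r w - snd r' w)"

definition local_zero :: "'v set \<Rightarrow> real \<times> ('v \<Rightarrow> real)" where
  "local_zero W = (0, \<lambda>w\<in>W. 0)"

lemma feasible_subset: "feasible V E C S sPhi sOmega v \<subseteq> local_space V E C S v"
  unfolding feasible_def local_space_def nominal_configs_def
  by (intro Sigma_mono image_subsetI subset_refl restrict_PiE_iff[THEN iffD2])
    (auto simp: in_nbrs_def PiE_iff)

lemma sigma_in_bool_local_space:
  assumes "C v = {c0, c1}" "c0 \<noteq> c1" "r \<in> local_space V E C S v"
  shows "sigma V E c0 c1 eta v r \<in> bool_local_space V E v"
proof -
  have "chi c0 c1 (fst r) \<in> {0, 1}"
    using assms by (auto simp: local_space_def chi_def)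
  moreover have "tau eta w (snd r w) \<in> {0, 1}" for w
    by (simp add: tau_def heaviside_def)
  ultimately show ?thesis
    by (simp add: bool_local_space_def local_space_def bool_space_def sigma_def case_prod_beta PiE_iff)
qed

lemma gamma_in_local_space:
  assumes "C v = {c0, c1}" "\<And>w. w \<in> V \<Longrightarrow> S w = UNIV" "r \<in> bool_local_space V E v"
  shows "gamma V E c0 c1 sPhi sOmega v r \<in> local_space V E C S v"
proof -
  have "chi_inv c0 c1 (fst r) \<in> C v"
    using assms by (auto simp: bool_local_space_def local_space_def bool_space_def chi_inv_def)
  then show ?thesis
    using assms(2) by (simp add: local_space_def gamma_def case_prod_beta PiE_iff in_nbrs_def)
qed

lemma chi_inv_chi: "c0 \<noteq> c1 \<Longrightarrow> chi_inv c0 c1 (chi c0 c1 c) = c"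
  by (simp add: chi_def chi_inv_def)

lemma chi_chi_inv: "c0 \<noteq> c1 \<Longrightarrow> chi c0 c1 (chi_inv c0 c1 c) = c"
  by (simp add: chi_def chi_inv_def)

end

theory Submission
  imports Defs
begin

text \<open>The Boolean dynamics is the affine dynamics with lifted arguments, thresholded at
  \<open>eta v\<close>: its two brackets are \<open>rho\<close> and \<open>chi_inv\<close> written
  out, so f' = \<tau> o f o \<gamma> holds by unfolding. The remaining point is that lifting undoes
  thresholding on feasible points (\<open>gamma_sigma_feasible\<close>), because each nominal state
  lies on its own side of the threshold. Hence f' o \<sigma> = \<tau> o f o \<gamma> o \<sigma> =
  \<tau> o f on F, and both error terms vanish.\<close>

lemma bool_dyn_eq_tau_affine_dyn_gamma:
  "bool_dyn V E c0 c1 eta sPhi sOmega A B h v r =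
   tau eta v (affine_dyn V E A B h v (gamma V E c0 c1 sPhi sOmega v r))"
  by (simp add: bool_dyn_def tau_def affine_dyn_def gamma_def rho_def chi_inv_def
      case_prod_beta cong: sum.cong)

text \<open>\<open>tau\<close> sends \<open>sPhi w\<close> to 0 and \<open>sOmega w\<close> to 1,
  and \<open>rho\<close> interpolates affinely from \<open>sPhi w\<close> at 0 to
  \<open>sOmega w\<close> at 1. The boundary case \<open>sOmega w = eta w\<close> works because
  \<open>heaviside 0 = 1\<close>.\<close>

lemma rho_tau_nominal:
  assumes "sPhi w < eta w" "eta w \<le> sOmega w" "s \<in> {sPhi w, sOmega w}"
  shows "rho sPhi sOmega w (tau eta w s) = s"
  using assms by (auto simp: rho_def tau_def heaviside_def)

text \<open>Both maps act coordinatewise: \<open>chi_inv\<close> inverts \<open>chi\<close> on the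
  control, and every state coordinate of a feasible point is nominal.\<close>

lemma gamma_sigma_feasible:
  assumes "c0 \<noteq> c1"
    and "\<And>w. w \<in> V \<Longrightarrow> sPhi w < eta w" and "\<And>w. w \<in> V \<Longrightarrow> eta w \<le> sOmega w"
    and "r \<in> feasible V E C S sPhi sOmega v"
  shows "gamma V E c0 c1 sPhi sOmega v (sigma V E c0 c1 eta v r) = r"
proof -
  \<comment> \<open>The global nominal configuration \<open>s\<close> witnesses feasibility; its
    restriction makes the state part extensional, as is the output of \<open>gamma\<close>, so
    equality on \<open>in_nbrs V E v\<close> suffices.\<close>
  obtain c s where r: "r = (c, restrict s (in_nbrs V E v))"
    and s: "\<And>w. w \<in> V \<Longrightarrow> s w \<in> {sPhi w, sOmega w}"
    using assms(4) unfolding feasible_def nominal_configs_def by blast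
  have "rho sPhi sOmega w (tau eta w (s w)) = s w" if "w \<in> in_nbrs V E v" for w
    using that assms(2,3) s by (intro rho_tau_nominal) (simp_all add: in_nbrs_def)
  then show ?thesis
    using assms(1) by (auto simp: r gamma_def sigma_def chi_inv_chi)
qed

theorem mainTheorem3:
  fixes V :: "'v set" and E :: "('v \<times> 'v) set"
    and c0 c1 :: real
    and C S Omega Phi :: "'v \<Rightarrow> real set"
    and eta sPhi sOmega h :: "'v \<Rightarrow> real"
    and A B :: "'v \<Rightarrow> 'v \<Rightarrow> real"
  assumes "finite V" and "E \<subseteq> V \<times> V" and "\<forall>v\<in>V. (v, v) \<in> E"
    and "c0 \<noteq> c1" and "\<forall>v\<in>V. C v = {c0, c1}"
    and "\<forall>v\<in>V. S v = UNIV"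
    and "\<forall>v\<in>V. Omega v = {eta v..}" and "\<forall>v\<in>V. Phi v = {..<eta v}"
    and "\<forall>v\<in>V. sPhi v \<in> Phi v" and "\<forall>v\<in>V. sOmega v \<in> Omega v"
    and "\<forall>w\<in>V. \<forall>v\<in>V. (w, v) \<notin> E \<longrightarrow> A w v = 0"
    and "\<forall>w\<in>V. \<forall>v\<in>V. w \<noteq> v \<longrightarrow> B w v = 0"
  shows "\<forall>v\<in>V.
    (let f = affine_dyn V E A B h v;
         f' = bool_dyn V E c0 c1 eta sPhi sOmega A B h v;
         \<tau> = tau eta v;
         \<sigma> = sigma V E c0 c1 eta v;
         \<gamma> = gamma V E c0 c1 sPhi sOmega v;
         F = feasible V E C S sPhi sOmega v;
         F' = bool_feasible V E C S sPhi sOmega c0 c1 eta v;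
         U = in_nbrs V E v
     in (\<forall>r \<in> bool_local_space V E v. f' r = (\<tau> \<circ> f \<circ> \<gamma>) r)
        \<and> (\<forall>r \<in> F. (f' \<circ> \<sigma>) r = (\<tau> \<circ> f) r)
        \<and> (\<forall>r \<in> F'. f' r - (\<tau> \<circ> f \<circ> \<gamma>) r = 0)
        \<and> (\<forall>r \<in> F. local_diff U ((\<gamma> \<circ> \<sigma>) r) r = local_zero U))"
proof -
  \<comment> \<open>This settles the conjuncts over F; those over Boolean points follow from the
    unfolding identity alone.\<close>
  have "gamma V E c0 c1 sPhi sOmega v (sigma V E c0 c1 eta v r) = r"
    if "r \<in> feasible V E C S sPhi sOmega v" for v r
    using assms(4,7-10) that by (intro gamma_sigma_feasible) auto
  then show ?thesis
    by (simp add: Let_def bool_dyn_eq_tau_affine_dyn_gamma local_diff_def local_zero_def)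
qed

end
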